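(* Let $\mathcal{P}$ be the set of integer partitions that satisfy Condition($2$) and in which $1+2+2$ does not occur as a sub-partition. Then, as formal power series in $x,q$, writing $N=i+2j+3k$, $$\sum_{\pi\in\mathcal{P}}x^{\ell(\pi)}q^{|\pi|}=\sum_{i,j,k\ge 0}\frac{x^{N}q^{\frac{N(N-1)}{2}+i+j^2+2j+2k}+x^{N+2}q^{\frac{(N+2)(N+1)}{2}+i+j^2+2j+2k+1}-x^{N+3}q^{\frac{(N+3)(N+2)}{2}+i+j^2+2j+2k+2}}{(q;q)_i\,(q^2;q^2)_j\,(q^3;q^3)_k}.$$
   Context: Partitions are finite weakly increasing sequences of positive integers (the empty partition is included); $\ell(\pi)$ is the number of parts and $|\pi|$ the sum of the parts of $\pi$. A sub-partition of a partition is a contiguous portion of it. For a fixed integer $c$, a partition $\pi=\lambda_1+\lambda_2+\cdots+\lambda_m$ with $\lambda_1\le\lambda_2\le\cdots\le\lambda_m$ satisfies Condition($c$) if $\lambda_{s+3}-\lambda_s\ge 3$ for all $1\le s\le m-3$, and, for all $1\le s\le m-2$, if $\lambda_{s+2}-\lambda_s\le 1$ then $\lambda_s+\lambda_{s+1}+\lambda_{s+2}\equiv c\pmod 3$. For $n\ge 0$, $(a;q)_n=\prod_{0\le t<n}(1-aq^t)$. All identities are identities of formal power series. *)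

theory Defs
  imports
    "HOL-Analysis.Analysis"
    "HOL-Computational_Algebra.Formal_Power_Series"
    "HOL-Library.Sublist"
    "HOL-Number_Theory.Cong"
begin

(* A partition is the list of its parts in weakly increasing order. *)
definition is_partition :: "nat list \<Rightarrow> bool" where
  "is_partition p \<longleftrightarrow> sorted p \<and> (\<forall>a\<in>set p. 0 < a)"

(* Lists are indexed from 0, so "1 \<le> s \<le> m - 3" becomes "s + 3 < m". *)
definition condition :: "int \<Rightarrow> nat list \<Rightarrow> bool" where
  "condition c p \<longleftrightarrow>
     (\<forall>s. s + 3 < length p \<longrightarrow> int (p ! (s + 3)) - int (p ! s) \<ge> 3) \<and>
     (\<forall>s. s + 2 < length p \<longrightarrow> int (p ! (s + 2)) - int (p ! s) \<le> 1 \<longrightarrow>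
        [int (p ! s) + int (p ! (s + 1)) + int (p ! (s + 2)) = c] (mod 3))"

(* Sub-partitions are contiguous, hence sublist rather than subseq. *)
definition partitions_P :: "nat list set" where
  "partitions_P = {p. is_partition p \<and> condition 2 p \<and> \<not> sublist [1, 2, 2] p}"

definition qpochhammer :: "'a::comm_ring_1 \<Rightarrow> 'a \<Rightarrow> nat \<Rightarrow> 'a" where
  "qpochhammer a q n = (\<Prod>t<n. 1 - a * q ^ t)"

(* Power series in x and q are series in q whose coefficients are series in x.
   Infinite sums refer to the library topology on fps, here the q-adic one; the sum
   over partitions would not converge x-adically, as infinitely many partitions have
   the same number of parts.  Division by a series with q-constant term 1 is
   multiplication by its inverse. *)
type_synonym bifps = "rat fps fps"

abbreviation q_var :: bifps where "q_var \<equiv> fps_X"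

abbreviation x_var :: bifps where "x_var \<equiv> fps_const fps_X"

end

theory Submission
  imports Defs
begin

unbundle no vec_syntax
unbundle fps_syntax

text \<open>Subtracting the staircase \<open>0, 1, 2, \<dots>\<close> from a partition that satisfies Condition(2) leaves a
  sequence that falls into consecutive levels \<open>a = 1, 2, \<dots>\<close>. The word at level \<open>a\<close> is an optional
  pair \<open>a, a - 1\<close>, then any number of triples \<open>a, a, a - 1\<close>, then any number of singles \<open>a\<close>, and
  the levels do not interact. So the generating function of these sequences is the product of
  \<open>(1 + x\<^sup>2 q\<^bsup>2a-1\<^esup>) / ((1 - x q\<^sup>a) (1 - x\<^sup>3 q\<^bsup>3a-1\<^esup>))\<close> over \<open>a \<ge> 1\<close>. Excluding \<open>1 + 2 + 2\<close>
  replaces its factor \<open>1 + x\<^sup>2 q\<close> by \<open>1 + x\<^sup>2 q - x\<^sup>3 q\<^sup>2\<close>, which accounts for the three terms of the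
  numerator; the Euler expansions of the rest give the triple sum, and restoring the staircase
  multiplies the coefficient of \<open>x\<^sup>N\<close> by \<open>q\<^bsup>N(N-1)/2\<^esup>\<close>.

  Formally, peeling off \<open>1, 1\<close> or \<open>1, 2, 2\<close> or \<open>1\<close> from the front and shifting the remaining parts
  gives a recurrence in the number of parts with a unique solution, and the product,
  through its functional equation under \<open>x \<mapsto> x q\<close>, provides that solution.\<close>

section \<open>Partitions satisfying Condition(2)\<close>

text \<open>For weakly increasing \<open>a \<le> b \<le> c\<close> with \<open>c \<le> a + 1\<close>, the congruence
  \<open>a + b + c \<equiv> 2 (mod 3)\<close> leaves only the pattern \<open>a, a + 1, a + 1\<close>.\<close>

fun admissible :: "nat list \<Rightarrow> bool" where
  "admissible [] = True"
| "admissible [a] = True"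
| "admissible [a, b] = (a \<le> b)"
| "admissible [a, b, c] = (a \<le> b \<and> b \<le> c \<and> (a + 2 \<le> c \<or> b = a + 1 \<and> c = a + 1))"
| "admissible (a # b # c # d # p) =
     (a \<le> b \<and> (a + 2 \<le> c \<or> b = a + 1 \<and> c = a + 1) \<and> a + 3 \<le> d \<and> admissible (b # c # d # p))"

lemma all_nat_iff: "(\<forall>s. P s) \<longleftrightarrow> P 0 \<and> (\<forall>s. P (Suc s))"
  by (metis not0_implies_Suc)

lemma condition_short: "length p \<le> 2 \<Longrightarrow> condition c p"
  by (auto simp: condition_def)

lemma condition_triple:
  "condition k [a, b, c] \<longleftrightarrow> (int c - int a \<le> 1 \<longrightarrow> [int a + int b + int c = k] (mod 3))"
  unfolding condition_def by (subst (2) all_nat_iff) auto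

lemma condition_Cons:
  "condition k (a # b # c # d # p) \<longleftrightarrow>
     int d - int a \<ge> 3 \<and> (int c - int a \<le> 1 \<longrightarrow> [int a + int b + int c = k] (mod 3)) \<and>
     condition k (b # c # d # p)"
  unfolding condition_def
  \<comment> \<open>Splitting off index 0 isolates the front window; the successor indices give the
    windows of the tail.\<close>
  apply (subst (1) all_nat_iff)
  apply (subst (2) all_nat_iff)
  apply (auto simp: numeral_3_eq_3 numeral_2_eq_2)
  done

lemma triple_cong_2_iff:
  fixes a b c :: nat
  assumes "a \<le> b" "b \<le> c"
  shows "(int c - int a \<le> 1 \<longrightarrow> [int a + int b + int c = 2] (mod 3)) \<longleftrightarrow>
    a + 2 \<le> c \<or> b = a + 1 \<and> c = a + 1"
proof -
  consider "a + 2 \<le> c" | "b = a" "c = a" | "b = a" "c = a + 1" | "b = a + 1" "c = a + 1"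
    using assms by linarith
  then show ?thesis
    unfolding cong_def by cases simp_all
qed

text \<open>Turns the quantification over indices into a recursion on windows of at most four parts,
  so that the front of a list can be analysed by case distinction.\<close>

lemma sorted_condition_iff_admissible: "sorted p \<and> condition 2 p \<longleftrightarrow> admissible p"
proof (induction p rule: admissible.induct)
  case (4 a b c)
  then show ?case
    using triple_cong_2_iff[of a b c] by (auto simp: condition_triple)
next
  case (5 a b c d p)
  have "sorted (a # b # c # d # p) \<and> condition 2 (a # b # c # d # p) \<longleftrightarrow>
      a \<le> b \<and> b \<le> c \<and> a + 3 \<le> d \<and>
      (int c - int a \<le> 1 \<longrightarrow> [int a + int b + int c = 2] (mod 3)) \<and>
      sorted (b # c # d # p) \<and> condition 2 (b # c # d # p)"
    by (auto simp: condition_Cons)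
  also have "\<dots> \<longleftrightarrow> a \<le> b \<and> b \<le> c \<and> a + 3 \<le> d \<and> (a + 2 \<le> c \<or> b = a + 1 \<and> c = a + 1) \<and>
      sorted (b # c # d # p) \<and> condition 2 (b # c # d # p)"
    using triple_cong_2_iff[of a b c] by blast
  also have "\<dots> \<longleftrightarrow> admissible (a # b # c # d # p)"
    using 5 by auto
  finally show ?case .
qed (simp_all add: condition_short)

lemma admissible_sorted: "admissible p \<Longrightarrow> sorted p"
  using sorted_condition_iff_admissible by blast

text \<open>Raising all parts by k changes a sum of three of them by 3k, which is invisible modulo
  3.\<close>

lemma admissible_shift: "admissible (map (\<lambda>a. a + k) p) \<longleftrightarrow> admissible p"
  by (induction p rule: admissible.induct) auto

section \<open>Peeling off an initial block\<close>

definition adm_partitions :: "nat list set" where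
  "adm_partitions = {p. admissible p \<and> 0 \<notin> set p}"

definition adm_no_11 :: "nat list set" where
  "adm_no_11 = {p \<in> adm_partitions. take 2 p \<noteq> [1, 1]}"

text \<open>Neither a pair nor a triple at level 1: the staircase \<open>0, 1\<close> turns
  \<open>1, 1\<close> into \<open>1, 0\<close>, and \<open>0, 1, 2\<close> turns
  \<open>1, 2, 2\<close> into \<open>1, 1, 0\<close>.\<close>

definition adm_no_11_122 :: "nat list set" where
  "adm_no_11_122 = {p \<in> adm_no_11. take 3 p \<noteq> [1, 2, 2]}"

text \<open>For a peeled block, k is the length of \<open>us\<close>, so that the staircase starts
  afresh on the remaining parts. \<open>glue [] 1\<close> instead raises every level by one.\<close>

definition glue :: "nat list \<Rightarrow> nat \<Rightarrow> nat list \<Rightarrow> nat list" where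
  "glue us k p = us @ map (\<lambda>a. a + k) p"

lemma inj_glue: "inj (glue us k)"
  by (auto simp: glue_def inj_def inj_map_eq_map)

lemma obtain_shift:
  fixes p :: "nat list"
  assumes "\<forall>a \<in> set p. k \<le> a"
  obtains p' where "p = map (\<lambda>a. a + k) p'"
proof -
  have "p = map (\<lambda>a. a + k) (map (\<lambda>a. a - k) p)"
    using assms by (induction p) auto
  then show thesis using that by blast
qed

text \<open>A level holds at most one pair: \<open>1, 1, 3, 3\<close> breaks the distance-3
  condition, so the rest comes from \<open>adm_no_11\<close>.\<close>

lemma adm_partitions_eq: "adm_partitions = adm_no_11 \<union> glue [1, 1] 2 ` adm_no_11"
proof (intro equalityI subsetI)
  fix p assume p: "p \<in> adm_partitions"
  show "p \<in> adm_no_11 \<union> glue [1, 1] 2 ` adm_no_11"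
  proof (cases "take 2 p = [1, 1]")
    case True
    then obtain r where r: "p = 1 # 1 # r"
      by (metis append_Cons append_Nil append_take_drop_id)
    \<comment> \<open>After \<open>1, 1\<close> the condition on triples rules out 1 and 2 as third
      part.\<close>
    have "\<forall>a \<in> set r. 3 \<le> a"
      using p admissible_sorted[of p] by (cases r; cases "tl r") (auto simp: r adm_partitions_def)
    moreover from this obtain p' where p': "r = map (\<lambda>a. a + 2) p'"
      by (metis obtain_shift Suc_leD eval_nat_numeral(3))
    ultimately have "0 \<notin> set p'" by auto
    moreover have "admissible r"
      using p by (cases r rule: admissible.cases) (auto simp: r adm_partitions_def)
    moreover have "take 2 p' \<noteq> [1, 1]"
      using p by (cases p' rule: admissible.cases) (auto simp: r p' adm_partitions_def)
    ultimately have "p' \<in> adm_no_11"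
      by (auto simp: adm_no_11_def adm_partitions_def p' admissible_shift[of 2, simplified])
    then show ?thesis by (auto simp: r p' glue_def)
  qed (use p in \<open>auto simp: adm_no_11_def\<close>)
next
  fix p assume "p \<in> adm_no_11 \<union> glue [1, 1] 2 ` adm_no_11"
  moreover have "glue [1, 1] 2 p' \<in> adm_partitions" if p': "p' \<in> adm_no_11" for p'
  proof -
    have "admissible (map (\<lambda>a. a + 2) p')" "sorted p'"
      using p' admissible_sorted[of p']
      by (auto simp: admissible_shift[of 2, simplified] adm_no_11_122_def adm_no_11_def adm_partitions_def)
    then show ?thesis
      using p' by (cases p' rule: admissible.cases)
        (auto simp: adm_no_11_122_def adm_no_11_def adm_partitions_def glue_def)
  qed
  ultimately show "p \<in> adm_partitions" by (auto simp: adm_no_11_def)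
qed

text \<open>Triples may repeat, as in \<open>1, 2, 2, 4, 5, 5\<close>, but a pair of the same level
  cannot follow, because \<open>2, 2, 4, 4\<close> breaks the distance-3 condition. Hence the rest
  is again in \<open>adm_no_11\<close>.\<close>

lemma adm_no_11_eq: "adm_no_11 = adm_no_11_122 \<union> glue [1, 2, 2] 3 ` adm_no_11"
proof (intro equalityI subsetI)
  fix p assume p: "p \<in> adm_no_11"
  show "p \<in> adm_no_11_122 \<union> glue [1, 2, 2] 3 ` adm_no_11"
  proof (cases "take 3 p = [1, 2, 2]")
    case True
    then obtain r where r: "p = 1 # 2 # 2 # r"
      by (metis append_Cons append_Nil append_take_drop_id)
    have "\<forall>a \<in> set r. 4 \<le> a"
      using p admissible_sorted[of p] by (cases r) (auto simp: r adm_no_11_def adm_partitions_def)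
    moreover from this obtain p' where p': "r = map (\<lambda>a. a + 3) p'"
      by (metis obtain_shift Suc_leD eval_nat_numeral(2) semiring_norm(26,27))
    ultimately have "0 \<notin> set p'" by auto
    moreover have "admissible r"
      using p by (cases r rule: admissible.cases) (auto simp: r adm_no_11_def adm_partitions_def)
    moreover have "take 2 p' \<noteq> [1, 1]"
      using p by (cases p' rule: admissible.cases) (auto simp: r p' adm_no_11_def adm_partitions_def)
    ultimately have "p' \<in> adm_no_11"
      by (auto simp: adm_no_11_def adm_partitions_def p' admissible_shift)
    then show ?thesis by (auto simp: r p' glue_def)
  qed (use p in \<open>auto simp: adm_no_11_122_def\<close>)
next
  fix p assume "p \<in> adm_no_11_122 \<union> glue [1, 2, 2] 3 ` adm_no_11"
  moreover have "glue [1, 2, 2] 3 p' \<in> adm_no_11" if p': "p' \<in> adm_no_11" for p'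
  proof -
    have "admissible (map (\<lambda>a. a + 3) p')" "sorted p'"
      using p' admissible_sorted[of p']
      by (auto simp: admissible_shift[of 3] adm_no_11_122_def adm_no_11_def adm_partitions_def)
    then show ?thesis
      using p' by (cases p' rule: admissible.cases)
        (auto simp: adm_no_11_122_def adm_no_11_def adm_partitions_def glue_def)
  qed
  ultimately show "p \<in> adm_no_11" by (auto simp: adm_no_11_122_def)
qed

text \<open>After a single 1, the rest starts with no pair and no triple of level 1:
  \<open>1, 2, 2\<close> is excluded by definition and \<open>1, 2, 3, 3\<close> by the distance-3
  condition. Without a part 1 only higher levels occur, and lowering all parts by 1 leaves an
  arbitrary admissible partition.\<close>

lemma adm_no_11_122_eq: "adm_no_11_122 = glue [1] 1 ` adm_no_11_122 \<union> glue [] 1 ` adm_partitions"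
proof (intro equalityI subsetI)
  fix p assume p: "p \<in> adm_no_11_122"
  show "p \<in> glue [1] 1 ` adm_no_11_122 \<union> glue [] 1 ` adm_partitions"
  proof (cases "take 1 p = [1]")
    case True
    then obtain r where r: "p = 1 # r"
      by (metis append_Cons append_Nil append_take_drop_id)
    have "\<forall>a \<in> set r. 2 \<le> a"
      using p admissible_sorted[of p]
      by (cases r) (auto simp: r adm_no_11_122_def adm_no_11_def adm_partitions_def)
    moreover from this obtain p' where p': "r = map (\<lambda>a. a + 1) p'"
      by (metis obtain_shift Suc_leD one_add_one plus_1_eq_Suc)
    ultimately have "0 \<notin> set p'" by auto
    moreover have "admissible r"
      using p by (cases r rule: admissible.cases)
        (auto simp: r adm_no_11_122_def adm_no_11_def adm_partitions_def)
    moreover have "take 2 p' \<noteq> [1, 1]" "take 3 p' \<noteq> [1, 2, 2]"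
      using p by (cases p' rule: admissible.cases;
          auto simp: r p' adm_no_11_122_def adm_no_11_def adm_partitions_def)+
    ultimately have "p' \<in> adm_no_11_122"
      by (auto simp: adm_no_11_122_def adm_no_11_def adm_partitions_def p' admissible_shift[of 1, simplified])
    then show ?thesis by (auto simp: r p' glue_def)
  next
    case False
    have "\<forall>a \<in> set p. 2 \<le> a"
      using p False admissible_sorted[of p]
      by (cases p) (auto simp: adm_no_11_122_def adm_no_11_def adm_partitions_def)
    moreover from this obtain p' where p': "p = map (\<lambda>a. a + 1) p'"
      by (metis obtain_shift Suc_leD one_add_one plus_1_eq_Suc)
    ultimately have "p' \<in> adm_partitions"
      using p by (auto simp: adm_no_11_122_def adm_no_11_def adm_partitions_def admissible_shift[of 1, simplified])
    then show ?thesis by (auto simp: p' glue_def)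
  qed
next
  fix p assume "p \<in> glue [1] 1 ` adm_no_11_122 \<union> glue [] 1 ` adm_partitions"
  moreover have "glue [1] 1 p' \<in> adm_no_11_122" if p': "p' \<in> adm_no_11_122" for p'
  proof -
    have "admissible (map (\<lambda>a. a + 1) p')" "sorted p'"
      using p' admissible_sorted[of p']
      by (auto simp: admissible_shift[of 1, simplified] adm_no_11_122_def adm_no_11_def adm_partitions_def)
    then show ?thesis
      using p' by (cases p' rule: admissible.cases)
        (auto simp: adm_no_11_122_def adm_no_11_def adm_partitions_def glue_def)
  qed
  moreover have "glue [] 1 p' \<in> adm_no_11_122" if p': "p' \<in> adm_partitions" for p'
  proof -
    have "admissible (map (\<lambda>a. a + 1) p')" "sorted p'"
      using p' admissible_sorted[of p']
      by (auto simp: admissible_shift[of 1, simplified] adm_no_11_122_def adm_no_11_def adm_partitions_def)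
    then show ?thesis
      using p' by (cases p' rule: admissible.cases)
        (auto simp: adm_no_11_122_def adm_no_11_def adm_partitions_def glue_def)
  qed
  ultimately show "p \<in> adm_no_11_122" by auto
qed

section \<open>Counting by length and size\<close>

text \<open>The index N is the exponent of x. Fixing length and sum together keeps the counted sets
  finite even for lists that contain 0.\<close>

definition count_series :: "nat list set \<Rightarrow> nat \<Rightarrow> rat fps" where
  "count_series S N = Abs_fps (\<lambda>n. of_nat (card {p \<in> S. length p = N \<and> sum_list p = n}))"

lemma finite_length_sum_list: "finite {p :: nat list \<in> S. length p = N \<and> sum_list p = n}"
proof (rule finite_subset)
  show "{p \<in> S. length p = N \<and> sum_list p = n} \<subseteq> {p. set p \<subseteq> {..n} \<and> length p = N}"
    by (auto intro: member_le_sum_list)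
qed (simp add: finite_lists_length_eq)

lemma count_series_Un:
  assumes "S \<inter> T = {}"
  shows "count_series (S \<union> T) N = count_series S N + count_series T N"
proof (rule fps_ext)
  fix n
  let ?c = "\<lambda>S :: nat list set. {p \<in> S. length p = N \<and> sum_list p = n}"
  have "?c (S \<union> T) = ?c S \<union> ?c T" by blast
  moreover have "?c S \<inter> ?c T = {}" using assms by blast
  ultimately have "card (?c (S \<union> T)) = card (?c S) + card (?c T)"
    by (simp only: card_Un_disjoint finite_length_sum_list)
  then show "count_series (S \<union> T) N $ n = (count_series S N + count_series T N) $ n"
    by (simp add: count_series_def)
qed

lemma sum_list_glue: "sum_list (glue us k p) = sum_list us + k * length p + sum_list p"
  unfolding glue_def by (induction p) auto

lemma length_glue: "length (glue us k p) = length us + length p"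
  by (simp add: glue_def)

lemma count_series_glue:
  "count_series (glue us k ` S) N =
    (if N < length us then 0
     else fps_X ^ (sum_list us + k * (N - length us)) * count_series S (N - length us))"
proof (rule fps_ext)
  fix n
  let ?m = "sum_list us + k * (N - length us)"
  let ?A = "{p \<in> glue us k ` S. length p = N \<and> sum_list p = n}"
  let ?B = "{p \<in> S. length p = N - length us \<and> sum_list p = n - ?m}"
  let ?C = "{p \<in> S. length us + length p = N \<and> sum_list us + k * length p + sum_list p = n}"
  have "?A = glue us k ` ?C"
    by (auto simp: sum_list_glue length_glue)
  then have "card ?A = card ?C"
    using inj_glue[THEN inj_on_subset, OF subset_UNIV] by (simp only: card_image)
  \<comment> \<open>The case distinction guards the truncated subtractions in
    \<open>?B\<close>.\<close>
  moreover have "?C = (if N < length us \<or> n < ?m then {} else ?B)"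
    by auto
  ultimately show "count_series (glue us k ` S) N $ n = (if N < length us then 0
     else fps_X ^ ?m * count_series S (N - length us)) $ n"
    by (auto simp: count_series_def fps_X_power_mult_nth)
qed

lemma count_series_glue_11:
  "count_series (glue [1, 1] 2 ` S) N =
    (if N < 2 then 0 else fps_X ^ (2 * N - 2) * count_series S (N - 2))"
proof (cases "N < 2")
  case False
  then have "sum_list [1, 1] + 2 * (N - length [1 :: nat, 1]) = 2 * N - 2" by simp
  moreover have "length [1 :: nat, 1] = 2" by simp
  ultimately show ?thesis by (simp only: count_series_glue)
qed (simp add: count_series_glue)

lemma count_series_glue_122:
  "count_series (glue [1, 2, 2] 3 ` S) N =
    (if N < 3 then 0 else fps_X ^ (3 * N - 4) * count_series S (N - 3))"
proof (cases "N < 3")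
  case False
  then have "sum_list [1, 2, 2] + 3 * (N - length [1 :: nat, 2, 2]) = 3 * N - 4" by simp
  moreover have "length [1 :: nat, 2, 2] = 3" by simp
  ultimately show ?thesis by (simp only: count_series_glue)
qed (simp add: count_series_glue)

lemma count_series_adm:
  "count_series adm_partitions N = count_series adm_no_11 N +
     (if N < 2 then 0 else fps_X ^ (2 * N - 2) * count_series adm_no_11 (N - 2))"
proof -
  have "adm_no_11 \<inter> glue [1, 1] 2 ` adm_no_11 = {}"
    by (auto simp: adm_no_11_def glue_def)
  then show ?thesis
    by (subst adm_partitions_eq) (simp only: count_series_Un count_series_glue_11)
qed

lemma count_series_no_11:
  "count_series adm_no_11 N = count_series adm_no_11_122 N +
     (if N < 3 then 0 else fps_X ^ (3 * N - 4) * count_series adm_no_11 (N - 3))"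
proof -
  have "adm_no_11_122 \<inter> glue [1, 2, 2] 3 ` adm_no_11 = {}"
    by (auto simp: adm_no_11_122_def glue_def)
  then show ?thesis
    by (subst adm_no_11_eq) (simp only: count_series_Un count_series_glue_122)
qed

lemma count_series_no_11_122:
  "count_series adm_no_11_122 N = fps_X ^ N * count_series adm_partitions N +
     (if N = 0 then 0 else fps_X ^ N * count_series adm_no_11_122 (N - 1))"
proof -
  have "glue [1] 1 ` adm_no_11_122 \<inter> glue [] 1 ` adm_partitions = {}"
    by (auto simp: adm_partitions_def glue_def Cons_eq_map_conv)
  moreover have "1 + (N - 1) = N" if "N > 0"
    using that by simp
  ultimately show ?thesis
    by (subst adm_no_11_122_eq) (cases "N = 0", auto simp: count_series_Un count_series_glue)
qed

text \<open>A part in front of \<open>1, 2, 2\<close> would have to be 1, and \<open>1, 1, 2\<close>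
  has sum 4, which is not 2 modulo 3. So the forbidden pattern can occur only at the front.\<close>

lemma partitions_P_eq: "partitions_P = adm_partitions - glue [1, 2, 2] 3 ` adm_no_11"
proof -
  have L: "is_partition p \<and> condition 2 p \<longleftrightarrow> p \<in> adm_partitions" for p
    using sorted_condition_iff_admissible[of p]
    by (auto simp: is_partition_def adm_partitions_def intro: gr0I)
  have "sublist [1, 2, 2] p \<longleftrightarrow> take 3 p = [1, 2, 2]" if p: "p \<in> adm_partitions" for p
  proof
    assume "sublist [1, 2, 2] p"
    then obtain us vs where uv: "p = us @ [1, 2, 2] @ vs"
      by (auto simp: sublist_def)
    have "us = []"
    proof (rule ccontr)
      assume "us \<noteq> []"
      then obtain us' a where us: "us = us' @ [a]"
        by (metis rev_exhaust)
      have "sorted p" "condition 2 p" "0 \<notin> set p"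
        using p L by (auto simp: is_partition_def adm_partitions_def)
      then have "a = 1"
        by (auto simp: uv us sorted_append intro: le_antisym gr0I)
      moreover have "[int a + 1 + 2 = 2] (mod 3)"
        using \<open>condition 2 p\<close> \<open>a = 1\<close>
        unfolding condition_def
        by (auto simp: uv us nth_append dest!: conjunct2 spec[of _ "length us'"])
      ultimately show False by (simp add: cong_def)
    qed
    then show "take 3 p = [1, 2, 2]" by (simp add: uv)
  next
    assume "take 3 p = [1, 2, 2]"
    then show "sublist [1, 2, 2] p" by (metis sublist_take)
  qed
  moreover have "p \<in> glue [1, 2, 2] 3 ` adm_no_11 \<longleftrightarrow> take 3 p = [1, 2, 2]" if "p \<in> adm_partitions" for p
  proof
    assume "take 3 p = [1, 2, 2]"
    moreover from this have "take 2 p \<noteq> [1, 1]"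
      by (cases p rule: admissible.cases) auto
    ultimately show "p \<in> glue [1, 2, 2] 3 ` adm_no_11"
      using that adm_no_11_eq by (auto simp: adm_no_11_def adm_no_11_122_def)
  qed (auto simp: glue_def)
  ultimately show ?thesis
    unfolding partitions_P_def using L by blast
qed

lemma count_series_P:
  "count_series partitions_P N = count_series adm_partitions N -
     (if N < 3 then 0 else fps_X ^ (3 * N - 4) * count_series adm_no_11 (N - 3))"
proof -
  have "adm_partitions = partitions_P \<union> glue [1, 2, 2] 3 ` adm_no_11"
    using partitions_P_eq adm_no_11_eq adm_partitions_eq by blast
  moreover have "partitions_P \<inter> glue [1, 2, 2] 3 ` adm_no_11 = {}"
    using partitions_P_eq by blast
  ultimately show ?thesis
    using count_series_Un[of partitions_P "glue [1, 2, 2] 3 ` adm_no_11" N]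
    by (simp only: count_series_glue_122 add_diff_cancel_right')
qed

lemma count_series_no_11_0: "count_series adm_no_11 0 = 1"
proof -
  have "{p \<in> adm_no_11. length p = 0 \<and> sum_list p = n} = (if n = 0 then {[]} else {})" for n
    by (auto simp: adm_no_11_def adm_partitions_def)
  then show ?thesis
    by (intro fps_ext) (simp add: count_series_def del: length_0_conv)
qed

section \<open>The product and its functional equation\<close>

text \<open>What the three terms of a summand share; the powers of x, the triangular exponents and
  the offsets 1 and 2 are added later.\<close>

definition weight :: "nat \<times> nat \<times> nat \<Rightarrow> rat fps" where
  "weight = (\<lambda>(i, j, k). fps_X ^ (i + j ^ 2 + 2 * j + 2 * k) *
     inverse (qpochhammer fps_X fps_X i * qpochhammer (fps_X ^ 2) (fps_X ^ 2) j *
       qpochhammer (fps_X ^ 3) (fps_X ^ 3) k))"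

definition exponent_triples :: "nat \<Rightarrow> (nat \<times> nat \<times> nat) set" where
  "exponent_triples N = {(i, j, k). i + 2 * j + 3 * k = N}"

lemma exponent_triples_subset: "exponent_triples N \<subseteq> {..N} \<times> {..N} \<times> {..N}"
  by (auto simp: exponent_triples_def)

lemma finite_exponent_triples: "finite (exponent_triples N)"
  using finite_subset[OF exponent_triples_subset] by simp

lemma qpochhammer_0 [simp]: "qpochhammer a q 0 = 1"
  by (simp add: qpochhammer_def)

lemma qpochhammer_power_Suc:
  "qpochhammer (q ^ r) (q ^ r) (Suc n) = qpochhammer (q ^ r) (q ^ r) n * (1 - q ^ (r * Suc n))"
  by (simp add: qpochhammer_def power_mult [symmetric] power_add)

lemma qpochhammer_nth_0:
  assumes "a $ 0 = 0"
  shows "qpochhammer a q n $ 0 = (1 :: 'a :: comm_ring_1)"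
  unfolding qpochhammer_def using assms by (induction n) auto

text \<open>Euler's functional equations, read coefficientwise, reduce to this. The free factor
  \<open>f\<close> takes the monomial that accompanies the reciprocal in each of the three series
  below.\<close>

lemma inverse_qpochhammer_Suc:
  fixes r :: nat
  assumes "r > 0"
  defines "P \<equiv> qpochhammer (fps_X ^ r) (fps_X ^ r) :: nat \<Rightarrow> rat fps"
  shows "f * inverse (P (Suc n)) =
    f * inverse (P n) + f * (fps_X ^ (r * Suc n) * inverse (P (Suc n)))"
proof -
  have "(1 - fps_X ^ (r * Suc n) :: rat fps) $ 0 \<noteq> 0"
    using assms by simp
  then have "inverse (1 - fps_X ^ (r * Suc n) :: rat fps) * (1 - fps_X ^ (r * Suc n)) = 1"
    by (rule inverse_mult_eq_1)
  then have "inverse (P (Suc n)) * (1 - fps_X ^ (r * Suc n)) = inverse (P n)"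
    unfolding P_def qpochhammer_power_Suc fps_inverse_mult by (simp add: mult.assoc)
  then have "inverse (P (Suc n)) =
      inverse (P n) + fps_X ^ (r * Suc n) * inverse (P (Suc n))"
    by (simp add: algebra_simps)
  from arg_cong[OF this, of "\<lambda>g. f * g"] show ?thesis
    unfolding distrib_left .
qed

text \<open>The substitution \<open>x \<mapsto> x q\<close>, for series in \<open>x\<close> whose coefficients are series in \<open>q\<close>.\<close>
definition qshift :: "rat fps fps \<Rightarrow> rat fps fps" where
  "qshift F = Abs_fps (\<lambda>n. fps_X ^ n * F $ n)"

lemma qshift_nth [simp]: "qshift F $ n = fps_X ^ n * F $ n"
  by (simp add: qshift_def)

lemma qshift_mult: "qshift (F * G) = qshift F * qshift G"
proof (rule fps_ext)
  fix n
  have "fps_X ^ n * (F $ i * G $ (n - i)) = (fps_X ^ i * F $ i) * (fps_X ^ (n - i) * G $ (n - i))"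
    if "i \<le> n" for i
  proof -
    have "(fps_X :: rat fps) ^ n = fps_X ^ i * fps_X ^ (n - i)"
      using that by (simp flip: power_add)
    then show ?thesis by (simp add: mult_ac)
  qed
  then show "qshift (F * G) $ n = (qshift F * qshift G) $ n"
    unfolding fps_mult_nth sum_distrib_left qshift_nth
    by (intro sum.cong refl) (simp only: atLeastAtMost_iff)
qed

lemma nth_one_plus_monom_mult:
  fixes F :: "'a :: comm_ring_1 fps"
  shows "((1 + fps_const c * fps_X ^ r) * F) $ n = F $ n + (if n < r then 0 else c * F $ (n - r))"
  by (simp add: distrib_right left_diff_distrib mult.assoc fps_X_power_mult_nth)

lemma nth_one_minus_monom_mult:
  fixes F :: "'a :: comm_ring_1 fps"
  shows "((1 - fps_const c * fps_X ^ r) * F) $ n = F $ n - (if n < r then 0 else c * F $ (n - r))"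
  by (simp add: distrib_right left_diff_distrib mult.assoc fps_X_power_mult_nth)

section \<open>Euler expansions of the factors for singles, pairs and triples\<close>

definition singles :: "rat fps fps" where
  "singles = Abs_fps (\<lambda>n. fps_X ^ n * inverse (qpochhammer fps_X fps_X n))"

text \<open>Euler's expansion of the product of 1 + x^2 q^(2a-1) over a >= 2, since the exponent is
  j(j-1) + 3j. The factor a = 1 is left out to match \<open>adm_no_11\<close>;
  \<open>singles\<close> and \<open>triplets\<close> stand for the products of 1/(1 - x q^a) and
  1/(1 - x^3 q^(3a-1)) over all a >= 1.\<close>

definition pairs :: "rat fps fps" where
  "pairs = Abs_fps (\<lambda>n. if 2 dvd n then fps_X ^ ((n div 2) ^ 2 + 2 * (n div 2)) *
     inverse (qpochhammer (fps_X ^ 2) (fps_X ^ 2) (n div 2)) else 0)"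

definition triplets :: "rat fps fps" where
  "triplets = Abs_fps (\<lambda>n. if 3 dvd n then fps_X ^ (2 * (n div 3)) *
     inverse (qpochhammer (fps_X ^ 3) (fps_X ^ 3) (n div 3)) else 0)"

text \<open>Replacing x by x q turns the factor of level a into that of level a + 1, so only the
  first factor is lost. The same holds for \<open>pairs\<close> and \<open>triplets\<close>.\<close>

lemma singles_qshift: "(1 - fps_const fps_X * fps_X ^ 1) * singles = qshift singles"
proof (rule fps_ext)
  fix n
  show "((1 - fps_const fps_X * fps_X ^ 1) * singles) $ n = qshift singles $ n"
  proof (cases n)
    case (Suc m)
    let ?P = "\<lambda>i. inverse (qpochhammer fps_X fps_X i) :: rat fps"
    have "fps_X ^ Suc m * ?P (Suc m) =
        fps_X ^ Suc m * ?P m + fps_X ^ Suc m * (fps_X ^ Suc m * ?P (Suc m))"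
      using inverse_qpochhammer_Suc[of 1 "fps_X ^ Suc m" m]
      unfolding power_one_right mult_1 by simp
    then show ?thesis
      unfolding nth_one_minus_monom_mult by (simp add: Suc singles_def mult_ac)
  qed (simp add: nth_one_minus_monom_mult singles_def)
qed

lemma pairs_qshift: "pairs = (1 + fps_const (fps_X ^ 3) * fps_X ^ 2) * qshift pairs"
proof (rule fps_ext)
  fix n
  show "pairs $ n = ((1 + fps_const (fps_X ^ 3) * fps_X ^ 2) * qshift pairs) $ n"
  proof (cases "2 dvd n \<and> n \<noteq> 0")
    case True
    then obtain j where n: "n = 2 * Suc j"
      by (metis dvdE mult_0_right not0_implies_Suc)
    let ?P = "\<lambda>j. inverse (qpochhammer (fps_X ^ 2) (fps_X ^ 2) j) :: rat fps"
    let ?e = "(Suc j) ^ 2 + 2 * Suc j"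
    have nth: "pairs $ (2 * j) = fps_X ^ (j ^ 2 + 2 * j) * ?P j" for j
      by (simp add: pairs_def)
    have 1: "pairs $ (2 * Suc j) =
        fps_X ^ ?e * ?P j + fps_X ^ (2 * Suc j) * pairs $ (2 * Suc j)"
      using inverse_qpochhammer_Suc[OF zero_less_numeral, of "fps_X ^ ?e" "num.Bit0 num.One" j]
      unfolding nth mult.left_commute[of "fps_X ^ ?e" "fps_X ^ (2 * Suc j)"] .
    \<comment> \<open>The 3 comes from the factor 1 + x^2 q^3, the 2j from \<open>qshift\<close>,
      and the rest is the exponent in the preceding coefficient.\<close>
    have "?e = 3 + (2 * j + (j ^ 2 + 2 * j))"
      by (simp add: power2_eq_square)
    then have 2: "fps_X ^ ?e * ?P j = fps_X ^ 3 * (fps_X ^ (2 * j) * pairs $ (2 * j))"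
      by (simp only: nth power_add mult.assoc)
    have "\<not> 2 * Suc j < 2" "2 * Suc j - 2 = 2 * j" by auto
    then show ?thesis
      unfolding n
      by (intro trans[OF 1])
        (simp only: nth_one_plus_monom_mult qshift_nth 2 if_False, rule add.commute)
  next
    case False
    then show ?thesis
      unfolding nth_one_plus_monom_mult by (auto simp: pairs_def)
  qed
qed

lemma triplets_qshift: "(1 - fps_const (fps_X ^ 2) * fps_X ^ 3) * triplets = qshift triplets"
proof (rule fps_ext)
  fix n
  show "((1 - fps_const (fps_X ^ 2) * fps_X ^ 3) * triplets) $ n = qshift triplets $ n"
  proof (cases "3 dvd n \<and> n \<noteq> 0")
    case True
    then obtain k where n: "n = 3 * Suc k"
      by (metis dvdE mult_0_right not0_implies_Suc)
    let ?P = "\<lambda>j. inverse (qpochhammer (fps_X ^ 3) (fps_X ^ 3) j) :: rat fps"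
    let ?e = "2 * Suc k"
    have nth: "triplets $ (3 * k) = fps_X ^ (2 * k) * ?P k" for k
      by (simp add: triplets_def)
    have 1: "triplets $ (3 * Suc k) =
        fps_X ^ ?e * ?P k + fps_X ^ (3 * Suc k) * triplets $ (3 * Suc k)"
      using inverse_qpochhammer_Suc[OF zero_less_numeral, of "fps_X ^ ?e" "num.Bit1 num.One" k]
      unfolding nth mult.left_commute[of "fps_X ^ ?e" "fps_X ^ (3 * Suc k)"] .
    have 2: "fps_X ^ ?e * ?P k = fps_X ^ 2 * triplets $ (3 * k)"
      by (simp only: nth mult_Suc_right power_add mult.assoc)
    have "\<not> 3 * Suc k < 3" "3 * Suc k - 3 = 3 * k" by auto
    then have "((1 - fps_const (fps_X ^ 2) * fps_X ^ 3) * triplets) $ (3 * Suc k) =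
        triplets $ (3 * Suc k) - fps_X ^ ?e * ?P k"
      by (simp only: nth_one_minus_monom_mult 2 if_False)
    also have "\<dots> = qshift triplets $ (3 * Suc k)"
      unfolding qshift_nth by (subst 1) (rule add_diff_cancel_left')
    finally show ?thesis unfolding n .
  next
    case False
    then show ?thesis
      unfolding nth_one_minus_monom_mult by (auto simp: triplets_def dvd_minus_self)
  qed
qed

text \<open>The generating function of \<open>adm_no_11\<close> once the staircase is
  removed.\<close>

definition jagged :: "rat fps fps" where
  "jagged = singles * pairs * triplets"

lemma jagged_nth: "jagged $ N = (\<Sum>t\<in>exponent_triples N. weight t)"
proof -
  \<comment> \<open>Here m is the x-degree of the product of the first two series and i that of
    \<open>singles\<close>. Nonzero terms need m - i = 2j and N - m = 3k.\<close>
  let ?g = "\<lambda>(m, i). singles $ i * pairs $ (m - i) * triplets $ (N - m)"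
  let ?S = "Sigma {0..N} (\<lambda>m. {0..m})"
  let ?S' = "{(m, i) \<in> ?S. 2 dvd m - i \<and> 3 dvd N - m}"
  have "jagged $ N = (\<Sum>x\<in>?S. ?g x)"
    by (simp add: jagged_def fps_mult_nth[of _ triplets] fps_mult_nth[of singles] sum_distrib_right
        sum.Sigma)
  also have "\<dots> = (\<Sum>x\<in>?S'. ?g x)"
  proof (rule sum.mono_neutral_right)
    show "\<forall>x\<in>?S - ?S'. ?g x = 0"
    proof
      fix x assume x: "x \<in> ?S - ?S'"
      obtain m i where mi: "x = (m, i)" by fastforce
      with x consider "\<not> 2 dvd m - i" | "\<not> 3 dvd N - m" by blast
      then have "pairs $ (m - i) = 0 \<or> triplets $ (N - m) = 0"
        by cases (simp_all only: pairs_def triplets_def fps_nth_Abs_fps if_False simp_thms)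
      then show "?g x = 0" unfolding mi by auto
    qed
  qed auto
  also have "\<dots> = (\<Sum>t\<in>exponent_triples N. weight t)"
  proof -
    let ?h = "\<lambda>(i, j, k). (i + 2 * j, i)"
    have "?S' = ?h ` exponent_triples N"
    proof (intro equalityI subsetI)
      fix x assume "x \<in> ?S'"
      then obtain m i where x: "x = (m, i)" "i \<le> m" "m \<le> N" "2 dvd m - i" "3 dvd N - m"
        by auto
      then obtain j k where "m - i = 2 * j" "N - m = 3 * k"
        by (elim dvdE)
      with x have "(i, j, k) \<in> exponent_triples N" "x = ?h (i, j, k)"
        by (auto simp: exponent_triples_def)
      then show "x \<in> ?h ` exponent_triples N" by (rule rev_image_eqI)
    qed (auto simp: exponent_triples_def)
    moreover have "inj_on ?h (exponent_triples N)"
      by (auto simp: inj_on_def exponent_triples_def)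
    moreover have "?g (?h t) = weight t" if "t \<in> exponent_triples N" for t
    proof -
      obtain i j k where t: "t = (i, j, k)" by (cases t)
      with that have "N - (i + 2 * j) = 3 * k" "i + 2 * j - i = 2 * j"
        by (auto simp: exponent_triples_def)
      moreover have "i + j ^ 2 + 2 * j + 2 * k = i + (j ^ 2 + 2 * j) + 2 * k"
        by simp
      ultimately show ?thesis
        unfolding t weight_def
        by (simp add: singles_def pairs_def triplets_def fps_inverse_mult power_add mult_ac
            del: One_nat_def)
    qed
    ultimately show ?thesis
      by (simp only: sum.reindex o_def cong: sum.cong)
  qed
  finally show ?thesis .
qed

text \<open>Both sides are the product over the levels a >= 2: on the left, level 1 loses its
  singles and triples; on the right, level 1 regains its pair and then every level moves up by
  one.\<close>

lemma jagged_functional_equation: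
  "(1 - fps_const fps_X * fps_X ^ 1) * ((1 - fps_const (fps_X ^ 2) * fps_X ^ 3) * jagged) =
    qshift ((1 + fps_const fps_X * fps_X ^ 2) * jagged)"
proof -
  have "qshift (1 + fps_const fps_X * fps_X ^ 2) = 1 + fps_const (fps_X ^ 3) * fps_X ^ 2"
  proof (rule fps_ext)
    fix n
    have nth: "(1 + fps_const c * fps_X ^ 2 :: rat fps fps) $ n =
        (if n = 0 then 1 else if n = 2 then c else 0)" for c
      by (simp add: fps_mult_left_const_nth)
    have "fps_X ^ 2 * fps_X = (fps_X ^ 3 :: rat fps)"
      by (simp only: power3_eq_cube power2_eq_square)
    then show "qshift (1 + fps_const fps_X * fps_X ^ 2) $ n =
        (1 + fps_const (fps_X ^ 3) * fps_X ^ 2) $ n"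
      unfolding qshift_nth nth by (simp only: power_0 mult_1_right mult_zero_right split: if_split) simp
  qed
  then have "qshift ((1 + fps_const fps_X * fps_X ^ 2) * jagged) =
      qshift singles * ((1 + fps_const (fps_X ^ 3) * fps_X ^ 2) * qshift pairs) * qshift triplets"
    by (simp add: jagged_def qshift_mult mult_ac)
  also have "\<dots> = (1 - fps_const fps_X * fps_X ^ 1) * singles * pairs *
      ((1 - fps_const (fps_X ^ 2) * fps_X ^ 3) * triplets)"
    by (simp only: singles_qshift triplets_qshift flip: pairs_qshift)
  finally show ?thesis
    by (simp add: jagged_def mult_ac)
qed

text \<open>The coefficient of x^N in the functional equation; \<open>d\<close> corresponds to lists
  with neither a pair nor a triple at level 1.\<close>

lemma jagged_recurrence:
  fixes N :: nat
  defines "d \<equiv> \<lambda>N. jagged $ N - (if N < 3 then 0 else fps_X ^ 2 * jagged $ (N - 3))"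
  shows "d N = (if N = 0 then 0 else fps_X * d (N - 1)) +
    fps_X ^ N * (jagged $ N + (if N < 2 then 0 else fps_X * jagged $ (N - 2)))"
proof -
  have d: "((1 - fps_const (fps_X ^ 2) * fps_X ^ 3) * jagged) $ N = d N" for N
    by (simp only: nth_one_minus_monom_mult d_def)
  have "d N - (if N < 1 then 0 else fps_X * d (N - 1)) =
      fps_X ^ N * (jagged $ N + (if N < 2 then 0 else fps_X * jagged $ (N - 2)))"
    using arg_cong[OF jagged_functional_equation, of "\<lambda>F. F $ N"]
    by (simp only: nth_one_minus_monom_mult[of fps_X] d qshift_nth nth_one_plus_monom_mult)
  then show ?thesis
    by (simp add: algebra_simps split: if_splits)
qed

section \<open>Series in \<open>q\<close> as bivariate series\<close>

text \<open>Views a series in q as constant in x, with q as the outer variable as in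
  \<open>bifps\<close>. Denominators can thus be inverted over a field first.\<close>

definition lift_q :: "'a :: comm_ring_1 fps \<Rightarrow> 'a fps fps" where
  "lift_q f = Abs_fps (\<lambda>n. fps_const (f $ n))"

lemma lift_q_nth [simp]: "lift_q f $ n = fps_const (f $ n)"
  by (simp add: lift_q_def)

lemma lift_q_1 [simp]: "lift_q 1 = 1"
  by (rule fps_ext) simp

lemma lift_q_X [simp]: "lift_q fps_X = fps_X"
  by (rule fps_ext) (simp add: fps_X_def)

lemma lift_q_diff: "lift_q (f - g) = lift_q f - lift_q g"
  by (rule fps_ext) simp

lemma fps_const_sum: "fps_const (sum f A) = (\<Sum>i\<in>A. fps_const (f i))"
  by (induction A rule: infinite_finite_induct) (auto simp flip: fps_const_add)

lemma lift_q_mult: "lift_q (f * g) = lift_q f * lift_q g"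
  by (rule fps_ext) (simp add: fps_mult_nth fps_const_sum)

lemma lift_q_power: "lift_q (f ^ n) = lift_q f ^ n"
  by (induction n) (simp_all add: lift_q_mult)

lemma lift_q_qpochhammer: "lift_q (qpochhammer a q n) = qpochhammer (lift_q a) (lift_q q) n"
  unfolding qpochhammer_def
  by (induction n) (simp_all add: lift_q_mult lift_q_diff lift_q_power)

text \<open>The coefficients of the bivariate series do not form a field. The right inverse given by
  the definition of \<open>inverse\<close> is therefore identified with the lifted inverse, a left
  inverse, by associativity.\<close>

lemma divide_lift_q:
  fixes P :: "'a :: field fps"
  assumes P: "P $ 0 = 1"
  shows "f / lift_q P = f * lift_q (inverse P)"
proof -
  let ?g = "lift_q P"
  have g0: "?g $ 0 = 1" by (simp add: P)
  then have "subdegree ?g = 0" by (intro subdegree_eq_0) simp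
  then have div: "f / ?g = f * inverse ?g"
    by (simp add: fps_divide_def)
  have "?g * inverse ?g = 1"
    unfolding fps_inverse_def[of ?g] by (rule fps_right_inverse) (simp add: P)
  moreover have "lift_q (inverse P) * ?g = 1"
    using P by (simp add: inverse_mult_eq_1 flip: lift_q_mult)
  ultimately have "inverse ?g = lift_q (inverse P)"
    using mult.assoc[of "lift_q (inverse P)" ?g "inverse ?g"] by simp
  with div show ?thesis by simp
qed

lemma x_power_lift_q_nth: "(x_var ^ N * lift_q f) $ n $ M = (if M = N then f $ n else 0)"
proof -
  have "(x_var ^ N * lift_q f) $ n = fps_X ^ N * fps_const (f $ n)"
    by (simp only: fps_const_power fps_mult_left_const_nth lift_q_nth)
  then show ?thesis
    by (auto simp: fps_X_power_mult_nth)
qed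

section \<open>Solving the recurrence\<close>

definition staircase :: "nat \<Rightarrow> nat" where
  "staircase N = N * (N - 1) div 2"

lemma staircase_0: "staircase 0 = 0"
  by (simp add: staircase_def)

lemma staircase_Suc: "staircase (Suc N) = staircase N + N"
proof (cases N)
  case (Suc m)
  have "Suc N * (Suc N - 1) = N * (N - 1) + N * 2"
    unfolding Suc by simp
  then show ?thesis
    unfolding staircase_def by simp
qed (simp add: staircase_def)

text \<open>The excess 1, 1, 2 on the right is the size of the block without its staircase:
  \<open>1\<close>, then \<open>1, 0\<close>, then \<open>1, 1, 0\<close>.\<close>

lemma staircase_shift:
  "N \<ge> 1 \<Longrightarrow> N + staircase (N - 1) = staircase N + 1"
  "N \<ge> 2 \<Longrightarrow> 2 * N - 2 + staircase (N - 2) = staircase N + 1"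
  "N \<ge> 3 \<Longrightarrow> 3 * N - 4 + staircase (N - 3) = staircase N + 2"
proof -
  show "N + staircase (N - 1) = staircase N + 1" if "N \<ge> 1"
  proof -
    from that obtain m where "N = Suc m" by (cases N) auto
    then show ?thesis by (simp add: staircase_Suc)
  qed
  show "2 * N - 2 + staircase (N - 2) = staircase N + 1" if "N \<ge> 2"
  proof -
    from that have "N = Suc (Suc (N - 2))" by simp
    then obtain m where "N = Suc (Suc m)" by blast
    then show ?thesis by (simp add: staircase_Suc)
  qed
  show "3 * N - 4 + staircase (N - 3) = staircase N + 2" if "N \<ge> 3"
  proof -
    from that have "N = Suc (Suc (Suc (N - 3)))" by simp
    then obtain m where "N = Suc (Suc (Suc m))" by blast
    then show ?thesis by (simp add: staircase_Suc)
  qed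
qed

text \<open>Applied to the series of \<open>adm_no_11\<close>, this operator and
  \<open>plus_11\<close> give those of \<open>adm_no_11_122\<close> and
  \<open>adm_partitions\<close>.\<close>

definition minus_122 :: "(nat \<Rightarrow> rat fps) \<Rightarrow> nat \<Rightarrow> rat fps" where
  "minus_122 e N = e N - (if N < 3 then 0 else fps_X ^ (3 * N - 4) * e (N - 3))"

definition plus_11 :: "(nat \<Rightarrow> rat fps) \<Rightarrow> nat \<Rightarrow> rat fps" where
  "plus_11 e N = e N + (if N < 2 then 0 else fps_X ^ (2 * N - 2) * e (N - 2))"

text \<open>The three decompositions merged into one recurrence for a single sequence.\<close>

definition staircase_recurrence :: "(nat \<Rightarrow> rat fps) \<Rightarrow> bool" where
  "staircase_recurrence e \<longleftrightarrow> (\<forall>N>0.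
     minus_122 e N = fps_X ^ N * plus_11 e N + fps_X ^ N * minus_122 e (N - 1))"

text \<open>The term of index N occurs on both sides of the recurrence. Subtracting leaves the
  factor 1 - q^N, which is cancellable for N > 0 and vanishes for N = 0, where the initial value
  takes over.\<close>

lemma staircase_recurrence_unique:
  assumes e: "staircase_recurrence e" and f: "staircase_recurrence f" and "e 0 = f 0"
  shows "e N = f N"
proof (induction N rule: less_induct)
  case (less N)
  show ?case
  proof (cases "N = 0")
    case False
    have 1: "minus_122 e N - minus_122 f N = e N - f N"
      "plus_11 e N - plus_11 f N = e N - f N"
      using less[of "N - 3"] less[of "N - 2"] by (auto simp: minus_122_def plus_11_def)
    have 2: "minus_122 e (N - 1) = minus_122 f (N - 1)"
      using less[of "N - 1"] less[of "N - 1 - 3"] False by (auto simp: minus_122_def)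
    have "minus_122 e N = fps_X ^ N * plus_11 e N + fps_X ^ N * minus_122 f (N - 1)"
      using e False unfolding staircase_recurrence_def 2[symmetric] by blast
    moreover have "minus_122 f N = fps_X ^ N * plus_11 f N + fps_X ^ N * minus_122 f (N - 1)"
      using f False unfolding staircase_recurrence_def by blast
    ultimately have "minus_122 e N - minus_122 f N = fps_X ^ N * (plus_11 e N - plus_11 f N)"
      by (simp only: right_diff_distrib add_diff_cancel_right)
    then have "(1 - fps_X ^ N) * (e N - f N) = 0"
      unfolding 1 by (simp add: left_diff_distrib)
    moreover have "(1 - fps_X ^ N :: rat fps) $ 0 \<noteq> 0"
      using False by simp
    then have "1 - fps_X ^ N \<noteq> (0 :: rat fps)"
      by (metis fps_zero_nth)
    ultimately show ?thesis by simp
  qed (use \<open>e 0 = f 0\<close> in simp)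
qed

lemma staircase_recurrence_count_series: "staircase_recurrence (count_series adm_no_11)"
proof -
  have "minus_122 (count_series adm_no_11) N = count_series adm_no_11_122 N" for N
    using count_series_no_11[of N] unfolding minus_122_def by (simp add: algebra_simps)
  moreover have "plus_11 (count_series adm_no_11) N = count_series adm_partitions N" for N
    by (simp only: plus_11_def count_series_adm)
  ultimately show ?thesis
    unfolding staircase_recurrence_def
    by (intro allI impI) (simp, subst count_series_no_11_122, simp)
qed

text \<open>The triangular exponent absorbs the powers of q that depend on N and leaves the fixed
  powers of \<open>jagged_recurrence\<close>.\<close>

lemma staircase_jagged:
  defines "e \<equiv> \<lambda>N. fps_X ^ staircase N * jagged $ N"
  shows "minus_122 e N =
      fps_X ^ staircase N * (jagged $ N - (if N < 3 then 0 else fps_X ^ 2 * jagged $ (N - 3)))"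
    and "plus_11 e N =
      fps_X ^ staircase N * (jagged $ N + (if N < 2 then 0 else fps_X * jagged $ (N - 2)))"
proof -
  have "fps_X ^ (3 * N - 4) * e (N - 3) = fps_X ^ staircase N * (fps_X ^ 2 * jagged $ (N - 3))"
    if "N \<ge> 3"
    using staircase_shift(3)[OF that] unfolding e_def
    by (simp only: mult.assoc[symmetric] power_add[symmetric])
  then show "minus_122 e N =
      fps_X ^ staircase N * (jagged $ N - (if N < 3 then 0 else fps_X ^ 2 * jagged $ (N - 3)))"
    unfolding minus_122_def by (auto simp: e_def right_diff_distrib)
  have "fps_X ^ (2 * N - 2) * e (N - 2) = fps_X ^ staircase N * (fps_X ^ 1 * jagged $ (N - 2))"
    if "N \<ge> 2"
    using staircase_shift(2)[OF that] unfolding e_def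
    by (simp only: mult.assoc[symmetric] power_add[symmetric])
  then show "plus_11 e N =
      fps_X ^ staircase N * (jagged $ N + (if N < 2 then 0 else fps_X * jagged $ (N - 2)))"
    unfolding plus_11_def by (auto simp: e_def distrib_left)
qed

lemma staircase_recurrence_jagged:
  "staircase_recurrence (\<lambda>N. fps_X ^ staircase N * jagged $ N)"
  unfolding staircase_recurrence_def staircase_jagged
proof (intro allI impI)
  fix N :: nat
  assume N: "N > 0"
  let ?d = "\<lambda>N. jagged $ N - (if N < 3 then 0 else fps_X ^ 2 * jagged $ (N - 3))"
  let ?l = "jagged $ N + (if N < 2 then 0 else fps_X * jagged $ (N - 2))"
  have "fps_X ^ staircase N * ?d N =
      fps_X ^ staircase N * (fps_X ^ 1 * ?d (N - 1) + fps_X ^ N * ?l)"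
    using jagged_recurrence[of N] N by (simp only: power_one_right if_False flip: neq0_conv)
  also have "\<dots> = fps_X ^ N * (fps_X ^ staircase N * ?l) +
      fps_X ^ (staircase N + 1) * ?d (N - 1)"
    by (simp only: distrib_left power_add mult_ac add_ac)
  also have "fps_X ^ (staircase N + 1) * ?d (N - 1) =
      fps_X ^ N * (fps_X ^ staircase (N - 1) * ?d (N - 1))"
    using staircase_shift(1)[of N] N by (simp only: power_add[symmetric] mult.assoc[symmetric])
  finally show "fps_X ^ staircase N * ?d N = fps_X ^ N * (fps_X ^ staircase N * ?l) +
      fps_X ^ N * (fps_X ^ staircase (N - 1) * ?d (N - 1))" .
qed

lemma jagged_nth_0: "jagged $ 0 = 1"
proof -
  have "exponent_triples 0 = {(0, 0, 0)}" by (auto simp: exponent_triples_def)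
  then show ?thesis by (simp add: jagged_nth weight_def)
qed

lemma count_series_no_11_jagged: "count_series adm_no_11 N = fps_X ^ staircase N * jagged $ N"
  by (rule staircase_recurrence_unique[OF staircase_recurrence_count_series
        staircase_recurrence_jagged])
    (simp add: count_series_no_11_0 staircase_0 jagged_nth_0)

lemma count_series_P_jagged:
  "count_series partitions_P N = fps_X ^ staircase N * (jagged $ N +
    (if N < 2 then 0 else fps_X * jagged $ (N - 2)) -
    (if N < 3 then 0 else fps_X ^ 2 * jagged $ (N - 3)))"
proof -
  \<comment> \<open>The subtracted difference is the contribution of the lists that begin with
    \<open>1, 2, 2\<close>.\<close>
  have "count_series partitions_P N =
      plus_11 (count_series adm_no_11) N - (count_series adm_no_11 N - minus_122 (count_series adm_no_11) N)"
    using count_series_P[of N] by (simp add: plus_11_def minus_122_def count_series_adm)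
  then show ?thesis
    unfolding count_series_no_11_jagged staircase_jagged by (simp add: algebra_simps)
qed

section \<open>Infinite sums of bivariate series\<close>

lemma weight_nth_eq_0:
  assumes "n < i + j + k"
  shows "weight (i, j, k) $ n = 0"
proof -
  have "n < i + j ^ 2 + 2 * j + 2 * k"
    using assms by simp
  then show ?thesis
    by (simp only: weight_def prod.case fps_X_power_mult_nth if_True)
qed

text \<open>Exchanges the variables: \<open>e\<close> is indexed by the x-degree, whereas q is the
  outer variable of \<open>bifps\<close>.\<close>

definition x_coeff_series :: "(nat \<Rightarrow> rat fps) \<Rightarrow> bifps" where
  "x_coeff_series e = Abs_fps (\<lambda>n. Abs_fps (\<lambda>N. e N $ n))"

lemma has_sum_partitions_P:
  "((\<lambda>p. x_var ^ length p * q_var ^ sum_list p) has_sum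
     x_coeff_series (count_series partitions_P)) partitions_P"
    (is "(?f has_sum _) _")
proof (rule has_sum_fpsI)
  fix n
  have nth: "?f p $ n $ N = (if N = length p \<and> sum_list p = n then 1 else 0)" for p N
    using x_power_lift_q_nth[of "length p" "fps_X ^ sum_list p" n N]
    by (auto simp: lift_q_power)
  have supp: "{p \<in> partitions_P. ?f p $ n \<noteq> 0} = {p \<in> partitions_P. sum_list p = n}"
    by (auto simp: fps_eq_iff nth)
  \<comment> \<open>Positive parts bound the length by the size, so each power of q meets only
    finitely many partitions.\<close>
  have "length p \<le> sum_list p" if "0 \<notin> set p" for p :: "nat list"
    using that by (induction p) auto
  then have "{p \<in> partitions_P. sum_list p = n} \<subseteq> {p. set p \<subseteq> {..n} \<and> length p \<le> n}"
    by (auto simp: partitions_P_eq adm_partitions_def intro: member_le_sum_list)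
  then have fin: "finite {p \<in> partitions_P. sum_list p = n}"
    by (rule finite_subset) (simp add: finite_lists_length_le)
  then show "finite {p \<in> partitions_P. ?f p $ n \<noteq> 0}"
    by (simp only: supp)
  show "x_coeff_series (count_series partitions_P) $ n =
      (\<Sum>p | p \<in> partitions_P \<and> ?f p $ n \<noteq> 0. ?f p $ n)"
  proof (rule fps_ext)
    fix N
    have "(\<Sum>p | p \<in> partitions_P \<and> sum_list p = n. ?f p $ n $ N) =
        (\<Sum>p | p \<in> partitions_P \<and> length p = N \<and> sum_list p = n. 1)"
      using fin by (intro sum.mono_neutral_cong_right) (auto simp: nth)
    then show "x_coeff_series (count_series partitions_P) $ n $ N =
        (\<Sum>p | p \<in> partitions_P \<and> ?f p $ n \<noteq> 0. ?f p $ n) $ N"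
      unfolding supp fps_sum_nth by (simp add: x_coeff_series_def count_series_def)
  qed
qed

lemma has_sum_exponent_triples:
  fixes s :: "nat \<times> nat \<times> nat \<Rightarrow> bifps"
  defines "wt \<equiv> \<lambda>(i, j, k). i + 2 * j + 3 * k"
  assumes s: "\<And>t. s t = x_var ^ wt t * lift_q (fps_X ^ staircase (wt t) * weight t)
     + x_var ^ (wt t + 2) * lift_q (fps_X ^ (staircase (wt t + 2) + 1) * weight t)
     - x_var ^ (wt t + 3) * lift_q (fps_X ^ (staircase (wt t + 3) + 2) * weight t)"
  shows "(s has_sum x_coeff_series (count_series partitions_P)) UNIV"
proof (rule has_sum_fpsI)
  fix n
  \<comment> \<open>Each guard identifies the argument of \<open>staircase\<close> with N.\<close>
  have nth: "s t $ n $ N = (if wt t = N then (fps_X ^ staircase N * weight t) $ n else 0)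
     + (if wt t + 2 = N then (fps_X ^ (staircase N + 1) * weight t) $ n else 0)
     - (if wt t + 3 = N then (fps_X ^ (staircase N + 2) * weight t) $ n else 0)" for t N
    unfolding s fps_add_nth fps_sub_nth x_power_lift_q_nth by auto
  \<comment> \<open>Each power of q therefore meets only finitely many triples.\<close>
  have zero: "s (i, j, k) $ n = 0" if "n < i + j + k" for i j k
  proof (rule fps_ext)
    fix N
    have "(fps_X ^ a * weight (i, j, k)) $ n = 0" for a
      using that weight_nth_eq_0[of "n - a" i j k] by (simp add: fps_X_power_mult_nth)
    then show "s (i, j, k) $ n $ N = 0 $ N"
      unfolding nth by (simp only: if_cancel fps_zero_nth add_0_left diff_self)
  qed
  have supp: "{t. s t $ n \<noteq> 0} \<subseteq> {..n} \<times> {..n} \<times> {..n}"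
  proof
    fix t assume "t \<in> {t. s t $ n \<noteq> 0}"
    moreover obtain i j k where t: "t = (i, j, k)" by (cases t)
    ultimately have "\<not> n < i + j + k" using zero by auto
    then show "t \<in> {..n} \<times> {..n} \<times> {..n}" by (simp add: t)
  qed
  then have fin: "finite {t. s t $ n \<noteq> 0}"
    by (rule finite_subset) simp
  then show "finite {t \<in> UNIV. s t $ n \<noteq> 0}" by simp
  show "x_coeff_series (count_series partitions_P) $ n = (\<Sum>t | t \<in> UNIV \<and> s t $ n \<noteq> 0. s t $ n)"
  proof (rule fps_ext)
    fix N
    \<comment> \<open>Large enough for the support at q-degree n and for all triples of x-degree at
      most N.\<close>
    let ?K = "{..max n N} \<times> {..max n N} \<times> {..max n N}"
    have part: "(\<Sum>t\<in>?K. if wt t + r = N then (fps_X ^ a * weight t) $ n else 0) =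
        (if N < r then 0 else fps_X ^ a * jagged $ (N - r)) $ n" for r a
    proof (cases "N < r")
      case False
      have "exponent_triples (N - r) \<subseteq> ?K"
        by (auto simp: exponent_triples_def)
      then have "(\<Sum>t\<in>?K. if wt t + r = N then (fps_X ^ a * weight t) $ n else 0) =
          (\<Sum>t\<in>exponent_triples (N - r). (fps_X ^ a * weight t) $ n)"
        using False by (intro sum.mono_neutral_cong_right) (auto simp: wt_def exponent_triples_def)
      then show ?thesis
        using False by (simp add: jagged_nth sum_distrib_left fps_sum_nth)
    qed (simp add: sum.neutral)
    have "(\<Sum>t | s t $ n \<noteq> 0. s t $ n) $ N = (\<Sum>t\<in>?K. s t $ n $ N)"
      unfolding fps_sum_nth using supp by (intro sum.mono_neutral_left) (auto simp: le_max_iff_disj)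
    \<comment> \<open>The three instances r = 0, 2, 3 of \<open>part\<close>; the guard
      \<open>N < 0\<close> is the vacuous one for r = 0.\<close>
    also have "\<dots> = (if N < 0 then 0 else fps_X ^ staircase N * jagged $ (N - 0)) $ n
       + (if N < 2 then 0 else fps_X ^ (staircase N + 1) * jagged $ (N - 2)) $ n
       - (if N < 3 then 0 else fps_X ^ (staircase N + 2) * jagged $ (N - 3)) $ n"
      unfolding part[symmetric] nth sum.distrib sum_subtractf by simp
    also have "\<dots> = count_series partitions_P N $ n"
      unfolding count_series_P_jagged
      by (auto simp: algebra_simps power_add power2_eq_square)
    finally show "x_coeff_series (count_series partitions_P) $ n $ N =
        (\<Sum>t | t \<in> UNIV \<and> s t $ n \<noteq> 0. s t $ n) $ N"
      by (simp add: x_coeff_series_def)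
  qed
qed

theorem mainTheorem8:
  fixes x q :: bifps and lhs :: "nat list \<Rightarrow> bifps" and rhs :: "nat \<times> nat \<times> nat \<Rightarrow> bifps"
  defines "x \<equiv> x_var" and "q \<equiv> q_var"
  defines "lhs \<equiv> (\<lambda>p. x ^ length p * q ^ sum_list p)"
  defines "rhs \<equiv> (\<lambda>(i, j, k).
      let N = i + 2 * j + 3 * k in
      (x ^ N * q ^ (N * (N - 1) div 2 + i + j ^ 2 + 2 * j + 2 * k)
       + x ^ (N + 2) * q ^ ((N + 2) * (N + 1) div 2 + i + j ^ 2 + 2 * j + 2 * k + 1)
       - x ^ (N + 3) * q ^ ((N + 3) * (N + 2) div 2 + i + j ^ 2 + 2 * j + 2 * k + 2))
      / (qpochhammer q q i * qpochhammer (q ^ 2) (q ^ 2) j * qpochhammer (q ^ 3) (q ^ 3) k))"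
  shows "lhs summable_on partitions_P \<and> rhs summable_on UNIV \<and> infsum lhs partitions_P = infsum rhs UNIV"
proof -
  let ?wt = "\<lambda>(i, j, k). i + 2 * j + 3 * k :: nat"
  have "rhs t = x_var ^ ?wt t * lift_q (fps_X ^ staircase (?wt t) * weight t)
     + x_var ^ (?wt t + 2) * lift_q (fps_X ^ (staircase (?wt t + 2) + 1) * weight t)
     - x_var ^ (?wt t + 3) * lift_q (fps_X ^ (staircase (?wt t + 3) + 2) * weight t)" for t
  proof -
    obtain i j k where t: "t = (i, j, k)" by (cases t)
    define N where "N = i + 2 * j + 3 * k"
    define m where "m = i + j ^ 2 + 2 * j + 2 * k"
    \<comment> \<open>The denominator as a series in q alone, to be inverted there and then
      lifted.\<close>
    define P :: "rat fps" where "P = qpochhammer fps_X fps_X i *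
      qpochhammer (fps_X ^ 2) (fps_X ^ 2) j * qpochhammer (fps_X ^ 3) (fps_X ^ 3) k"
    have P0: "P $ 0 = 1"
      by (simp add: P_def qpochhammer_nth_0)
    have weight: "weight t = fps_X ^ m * inverse P"
      by (simp add: t weight_def m_def P_def)
    have lift_P: "qpochhammer q q i * qpochhammer (q ^ 2) (q ^ 2) j * qpochhammer (q ^ 3) (q ^ 3) k =
        lift_q P"
      by (simp add: P_def q_def lift_q_mult lift_q_qpochhammer lift_q_power)
    have exponents: "N * (N - 1) div 2 + i + j ^ 2 + 2 * j + 2 * k = staircase N + m"
      "(N + 2) * (N + 1) div 2 + i + j ^ 2 + 2 * j + 2 * k + 1 = staircase (N + 2) + 1 + m"
      "(N + 3) * (N + 2) div 2 + i + j ^ 2 + 2 * j + 2 * k + 2 = staircase (N + 3) + 2 + m"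
      by (simp_all add: staircase_def m_def)
    have "rhs t = (x ^ N * q ^ (staircase N + m) + x ^ (N + 2) * q ^ (staircase (N + 2) + 1 + m)
        - x ^ (N + 3) * q ^ (staircase (N + 3) + 2 + m)) * lift_q (inverse P)"
      unfolding rhs_def t prod.case Let_def lift_P divide_lift_q[OF P0]
        N_def[symmetric] exponents ..
    then show ?thesis
      by (simp only: t[symmetric] weight x_def q_def lift_q_mult lift_q_power lift_q_X power_add
          distrib_right left_diff_distrib mult.assoc) (simp add: t N_def)
  qed
  then have "(rhs has_sum x_coeff_series (count_series partitions_P)) UNIV"
    by (rule has_sum_exponent_triples)
  moreover have "(lhs has_sum x_coeff_series (count_series partitions_P)) partitions_P"
    unfolding lhs_def x_def q_def by (rule has_sum_partitions_P)
  ultimately show ?thesis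
    using has_sum_imp_summable infsumI by metis
qed

end
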